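(* Let $T$ be large, $y\le(\log T)^2$ real, and $f$ a completely multiplicative function with $|f(n)|=1$ for all $n\in\mathbb N$. Let $$L_f(s,y)=\prod_{p\le y}\left(1-\frac{f(p)}{p^s}\right)^{-1}=\sum_{n\in S(y)}\frac{f(n)}{n^s},\qquad S(y)=\{n\in\mathbb N:\ p\mid n\Rightarrow p\le y\}.$$ If $z_1,z_2$ are complex numbers with $|z_1|,|z_2|\le\log T/(25\log_2T\log_3T)$, then $$\frac1T\int_T^{2T}L_f(1+it,y)^{z_1}\,\overline{L_f(1+it,y)}^{\,z_2}dt=\sum_{n\in S(y)}\frac{d_{z_1}(n)d_{z_2}(n)}{n^2}+O\left(\exp\left(-\frac{\log T}{4\log_2T}\right)\right).$$
   Context: $p$ runs over primes; $\log_j$ is the $j$-fold iterated logarithm. Complex powers are defined via $\log L_f(1+it,y)=\sum_{p\le y}-\log(1-f(p)p^{-1-it})$ with principal logarithms, i.e. $L_f^{z}=\exp(z\log L_f)$ and $\overline{L_f}^{\,z}=\exp(z\,\overline{\log L_f})$. For complex $z$, $d_z$ is the multiplicative function with $d_z(p^a)=\Gamma(z+a)/(\Gamma(z)a!)$. *)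

theory Defs
  imports "HOL-Analysis.Analysis" "HOL-Computational_Algebra.Primes"
begin

text \<open>The value at \<open>0\<close> is irrelevant: the arithmetic functions here live on the positive integers.\<close>

definition completely_multiplicative :: "(nat \<Rightarrow> complex) \<Rightarrow> bool" where
  "completely_multiplicative f \<longleftrightarrow>
     f 1 = 1 \<and> (\<forall>m n. m \<ge> 1 \<longrightarrow> n \<ge> 1 \<longrightarrow> f (m * n) = f m * f n)"

definition primes_upto :: "real \<Rightarrow> nat set" where
  "primes_upto y = {p. prime p \<and> real p \<le> y}"

definition smooth_numbers :: "real \<Rightarrow> nat set" where
  "smooth_numbers y = {n. n \<ge> 1 \<and> (\<forall>p. prime p \<longrightarrow> p dvd n \<longrightarrow> real p \<le> y)}"

definition L_fun :: "(nat \<Rightarrow> complex) \<Rightarrow> complex \<Rightarrow> real \<Rightarrow> complex" where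
  "L_fun f s y = (\<Prod>p\<in>primes_upto y. inverse (1 - f p / of_nat p powr s))"

definition log_L :: "(nat \<Rightarrow> complex) \<Rightarrow> complex \<Rightarrow> real \<Rightarrow> complex" where
  "log_L f s y = (\<Sum>p\<in>primes_upto y. - Ln (1 - f p / of_nat p powr s))"

text \<open>The powers of \<open>L_fun f s y\<close> and of its conjugate are taken with respect to the branch
  \<open>log_L\<close> (lemma \<open>exp_log_L\<close> below), not with respect to the principal logarithm of the product.\<close>

definition L_power :: "(nat \<Rightarrow> complex) \<Rightarrow> complex \<Rightarrow> real \<Rightarrow> complex \<Rightarrow> complex" where
  "L_power f s y z = exp (z * log_L f s y)"

definition cnj_L_power :: "(nat \<Rightarrow> complex) \<Rightarrow> complex \<Rightarrow> real \<Rightarrow> complex \<Rightarrow> complex" where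
  "cnj_L_power f s y z = exp (z * cnj (log_L f s y))"

text \<open>The quotient \<open>Gamma (z + a) / Gamma z\<close> is a polynomial in \<open>z\<close>. Since \<open>Gamma\<close> is \<open>0\<close> at its
  poles in HOL, the removable singularities at the non-positive integers are filled in by hand;
  see \<open>divisor_coeff_eq_pochhammer\<close>.\<close>

definition divisor_coeff :: "complex \<Rightarrow> nat \<Rightarrow> complex" where
  "divisor_coeff z a =
     (if z \<in> \<int>\<^sub>\<le>\<^sub>0 then pochhammer z a / fact a
      else Gamma (z + of_nat a) / (Gamma z * fact a))"

definition divisor_fun :: "complex \<Rightarrow> nat \<Rightarrow> complex" where
  "divisor_fun z n = (\<Prod>p\<in>prime_factors n. divisor_coeff z (multiplicity p n))"

lemma divisor_coeff_eq_pochhammer: "divisor_coeff z a = pochhammer z a / fact a"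
  by (simp add: divisor_coeff_def pochhammer_Gamma)

lemma finite_primes_upto: "finite (primes_upto y)"
proof (rule finite_subset)
  show "primes_upto y \<subseteq> {..nat \<lfloor>y\<rfloor>}"
    by (auto simp: primes_upto_def le_nat_floor)
qed simp

lemma exp_log_L:
  assumes "\<And>n. n \<ge> 1 \<Longrightarrow> norm (f n) = 1" and "Re s > 0"
  shows "exp (log_L f s y) = L_fun f s y"
proof -
  have "exp (- Ln (1 - f p / of_nat p powr s)) = inverse (1 - f p / of_nat p powr s)"
    if "p \<in> primes_upto y" for p
  proof -
    have p: "p > 1" using that prime_gt_1_nat unfolding primes_upto_def by blast
    have "norm (of_nat p powr s :: complex) = real p powr Re s"
      using p by (subst norm_powr_real_powr) auto
    moreover have "real p powr Re s > 1"
      using p assms(2) by simp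
    ultimately have "norm (f p / of_nat p powr s) < 1"
      using assms(1)[of p] p by (simp add: norm_divide)
    hence "1 - f p / of_nat p powr s \<noteq> 0" by auto
    thus ?thesis by (simp add: exp_minus)
  qed
  thus ?thesis
    by (simp add: log_L_def L_fun_def exp_sum[OF finite_primes_upto])
qed

end

theory Submission imports Defs begin

text \<open>Expanding both powers over \<open>y\<close>-smooth numbers, the mean value is a double sum over \<open>m, n\<close> of
  \<open>d\<^bsub>z1\<^esub>(m) d\<^bsub>z2\<^esub>(n) f(m) cnj (f(n)) / (m n)\<close> times the mean of \<open>(n/m)\<^bsup>it\<^esup>\<close>; the diagonal is the
  main term. Off the diagonal the mean of \<open>(n/m)\<^bsup>it\<^esup>\<close> is at most \<open>min 1 (2mn/T)\<close>, hence at most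
  \<open>(2mn/T)\<^bsup>\<delta>\<^esup>\<close> for every \<open>\<delta>\<close> between \<open>0\<close> and \<open>1\<close>, which separates the variables without any truncation:
  the error is at most \<open>(2/T)\<^bsup>\<delta>\<^esup>\<close> times the product over \<open>p \<le> y\<close> of \<open>(1 - p\<^bsup>\<delta>-1\<^esup>)\<^bsup>-|z1|-|z2|\<^esup>\<close>.
  With \<open>\<delta> = 1 / ln (ln T)\<close> the first factor is about \<open>exp (- ln T / ln (ln T))\<close>, and a crude Mertens
  bound shows that the second is at most \<open>exp (c ln T / ln (ln T))\<close> with \<open>c < 3/4\<close>.\<close>

subsection \<open>Finite Euler products\<close>

text \<open>Fubini for absolutely summable families: the row sums of norms are
  \<open>norm (f x)\<close> times a constant, so the product family is absolutely summable and may
  be summed row by row. It serves both to adjoin a prime to an Euler product and to expand a product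
  of two Dirichlet series.\<close>

lemma has_sum_Times_abs:
  fixes f :: "'a \<Rightarrow> 'c::{real_normed_field, banach}" and g :: "'b \<Rightarrow> 'c"
  assumes "(\<lambda>x. norm (f x)) summable_on A" "(\<lambda>x. norm (g x)) summable_on B"
    and "(f has_sum s) A" "(g has_sum t) B"
  shows "(\<lambda>(x,y). norm (f x * g y)) summable_on A \<times> B"
    and "((\<lambda>(x,y). f x * g y) has_sum s * t) (A \<times> B)"
proof -
  show norm: "(\<lambda>(x,y). norm (f x * g y)) summable_on A \<times> B"
  proof (rule summable_on_SigmaI)
    fix x assume "x \<in> A"
    show "((\<lambda>y. case (x, y) of (x, y) \<Rightarrow> norm (f x * g y)) has_sum norm (f x) * infsum (\<lambda>y. norm (g y)) B) B"
      using has_sum_cmult_right[OF has_sum_infsum[OF assms(2)], of "norm (f x)"] by (simp add: norm_mult)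
  next
    show "(\<lambda>x. norm (f x) * infsum (\<lambda>y. norm (g y)) B) summable_on A"
      by (intro summable_on_cmult_left assms)
  qed auto
  show "((\<lambda>(x,y). f x * g y) has_sum s * t) (A \<times> B)"
  proof (rule has_sum_SigmaI)
    show "((\<lambda>y. case (x, y) of (x, y) \<Rightarrow> f x * g y) has_sum f x * t) B" if "x \<in> A" for x
      using has_sum_cmult_right[OF assms(4)] by simp
    show "((\<lambda>x. f x * t) has_sum s * t) A"
      by (rule has_sum_cmult_left[OF assms(3)])
    show "(\<lambda>(x,y). f x * g y) summable_on A \<times> B"
      by (rule abs_summable_summable) (use norm in \<open>simp add: case_prod_unfold\<close>)
  qed
qed

lemma prime_factors_prime_power_mult:
  fixes p m :: nat
  assumes "prime p" "m > 0"
  shows "prime_factors (p ^ a * m) \<subseteq> insert p (prime_factors m)"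
proof
  fix q assume "q \<in> prime_factors (p ^ a * m)"
  then have "prime q" "q dvd p ^ a * m" by auto
  then have "prime q" "q dvd p ^ a \<or> q dvd m" by (simp_all add: prime_dvd_mult_iff)
  then show "q \<in> insert p (prime_factors m)"
    using assms by (auto simp: prime_factors_dvd dest: prime_dvd_power primes_dvd_imp_eq)
qed

text \<open>Induction on \<open>P\<close>: adjoining \<open>p\<close>, every admissible integer is
  uniquely \<open>p ^ a * m\<close> with \<open>m\<close> built from the old primes, so the new sum
  is a product of two absolutely summable ones. The coefficients live in a general field because the
  result is applied once to complex local terms and once to their norms. The condition
  \<open>c p 0 = 1\<close> is what lets \<open>F\<close> ignore primes that do not divide its
  argument.\<close>

lemma finite_Euler_product:
  fixes c :: "nat \<Rightarrow> nat \<Rightarrow> 'a::{real_normed_field, banach}"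
  assumes "finite P" "\<And>p. p \<in> P \<Longrightarrow> prime p" "\<And>p. c p 0 = 1"
    and "\<And>p. p \<in> P \<Longrightarrow> (\<lambda>a. norm (c p a)) summable_on UNIV"
    and "\<And>p. p \<in> P \<Longrightarrow> (c p has_sum s p) UNIV"
  defines "F \<equiv> \<lambda>n. \<Prod>p\<in>prime_factors n. c p (multiplicity p n)"
  shows "(\<lambda>n. norm (F n)) summable_on {n. n > 0 \<and> prime_factors n \<subseteq> P}"
    and "(F has_sum (\<Prod>p\<in>P. s p)) {n. n > 0 \<and> prime_factors n \<subseteq> P}"
proof -
  have *: "(\<lambda>n. norm (F n)) summable_on {n. n > 0 \<and> prime_factors n \<subseteq> P} \<and>
        (F has_sum (\<Prod>p\<in>P. s p)) {n. n > 0 \<and> prime_factors n \<subseteq> P}"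
    using assms(1,2,4,5)
  proof (induction P)
    case empty
    have "{n. n > 0 \<and> prime_factors n \<subseteq> {}} = {1::nat}"
      by (auto simp: prime_factorization_empty_iff)
    then show ?case using has_sum_finite[of "{1::nat}" F] by (simp add: F_def)
  next
    case (insert p P)
    define S where "S = {n::nat. n > 0 \<and> prime_factors n \<subseteq> P}"
    define S' where "S' = {n::nat. n > 0 \<and> prime_factors n \<subseteq> insert p P}"
    have p: "prime p" using insert by auto
    have IH: "(\<lambda>n. norm (F n)) summable_on S" "(F has_sum (\<Prod>p\<in>P. s p)) S"
      unfolding S_def using insert by auto
    have notdvd: "\<not> p dvd m" if "m \<in> S" for m
      using that p insert.hyps(2) by (auto simp: S_def prime_factors_dvd)
    have mult_p: "multiplicity p (p ^ a * m) = a" if "m \<in> S" for a m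
      using that p notdvd[OF that]
      by (subst prime_elem_multiplicity_mult_distrib) (auto simp: S_def not_dvd_imp_multiplicity_0)
    have F_mult: "F (p ^ a * m) = c p a * F m" if m: "m \<in> S" for a m
    proof -
      \<comment> \<open>For \<open>a = 0\<close> the prime \<open>p\<close> is missing from the
        prime factors of \<open>p ^ a * m\<close>. Padding the product with factors
        \<open>c q 0 = 1\<close> gives one index set for all \<open>a\<close>.\<close>
      have sub: "F n = (\<Prod>q\<in>insert p (prime_factors m). c q (multiplicity q n))"
        if "n > 0" "prime_factors n \<subseteq> insert p (prime_factors m)" for n
        unfolding F_def
      proof (intro prod.mono_neutral_left ballI)
        fix q assume q: "q \<in> insert p (prime_factors m) - prime_factors n"
        then have "prime q" using p by auto
        with q that(1) have "multiplicity q n = 0"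
          by (auto simp: prime_factors_dvd not_dvd_imp_multiplicity_0)
        then show "c q (multiplicity q n) = 1" by (simp add: assms(3))
      qed (use that in auto)
      have pm: "p \<notin> prime_factors m" using notdvd[OF m] by auto
      have "F (p ^ a * m) = (\<Prod>q\<in>insert p (prime_factors m). c q (multiplicity q (p ^ a * m)))"
        using m p prime_factors_prime_power_mult[OF p, of m a]
        by (intro sub) (auto simp: S_def prime_gt_0_nat)
      also have "\<dots> = c p a * (\<Prod>q\<in>prime_factors m. c q (multiplicity q (p ^ a * m)))"
        using pm mult_p[OF m] by simp
      also have "(\<Prod>q\<in>prime_factors m. c q (multiplicity q (p ^ a * m))) = F m"
        unfolding F_def
      proof (intro prod.cong refl)
        fix q assume q: "q \<in> prime_factors m"
        have "prime q" "q \<noteq> p" using q pm by auto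
        then have "multiplicity q (p ^ a) = 0"
          using p by (intro multiplicity_distinct_prime_power) auto
        then have "multiplicity q (p ^ a * m) = multiplicity q m"
          using p \<open>prime q\<close> m by (subst prime_elem_multiplicity_mult_distrib)
            (auto simp: S_def)
        then show "c q (multiplicity q (p ^ a * m)) = c q (multiplicity q m)" by simp
      qed
      finally show ?thesis .
    qed
    define j where "j = (\<lambda>(a,m). p ^ a * m)"
    \<comment> \<open>The exponent is recovered as the multiplicity of \<open>p\<close>, because
      \<open>p\<close> divides no element of \<open>S\<close>; the cofactor then follows by
      cancellation.\<close>
    have inj: "inj_on j (UNIV \<times> S)"
    proof (rule inj_onI, clarsimp simp: j_def)
      fix a m b n assume "p ^ a * m = p ^ b * n" "m \<in> S" "n \<in> S"
      moreover from this have "a = b"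
        using mult_p[of m a] mult_p[of n b] by simp
      ultimately show "a = b \<and> m = n" using p by (auto simp: prime_gt_0_nat)
    qed
    have img: "j ` (UNIV \<times> S) = S'"
    proof (intro equalityI subsetI)
      fix n assume "n \<in> j ` (UNIV \<times> S)"
      then obtain a m where "n = p ^ a * m" "m \<in> S" by (auto simp: j_def)
      then show "n \<in> S'" using prime_factors_prime_power_mult[OF p, of m a] p
        by (auto simp: S_def S'_def prime_gt_0_nat)
    next
      fix n assume n: "n \<in> S'"
      have "n \<noteq> 0" "\<not> is_unit p" using n p by (auto simp: S'_def)
      from multiplicity_decompose'[OF this] obtain a m where m: "n = p ^ a * m" "\<not> p dvd m"
        by metis
      have "m > 0" using m(2) by (auto intro: Nat.gr0I)
      moreover have "prime_factors m \<subseteq> insert p P"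
      proof -
        have "m dvd n" using m(1) by simp
        then show ?thesis using n dvd_prime_factors[of n m] by (auto simp: S'_def)
      qed
      moreover have "p \<notin> prime_factors m" using m(2) by auto
      ultimately have "m \<in> S" by (auto simp: S_def)
      then have "j (a, m) \<in> j ` (UNIV \<times> S)" by blast
      then show "n \<in> j ` (UNIV \<times> S)" using m(1) by (simp add: j_def)
    qed
    have c: "(\<lambda>a. norm (c p a)) summable_on UNIV" "(c p has_sum s p) UNIV"
      using insert.prems by auto
    note T = has_sum_Times_abs[OF c(1) IH(1) c(2) IH(2)]
    have "((\<lambda>n. norm (F n)) \<circ> j) summable_on UNIV \<times> S"
      using T(1) by (rule summable_on_cong[THEN iffD1, rotated]) (auto simp: j_def F_mult)
    moreover have "((F \<circ> j) has_sum (s p * (\<Prod>p\<in>P. s p))) (UNIV \<times> S)"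
      using T(2) by (rule has_sum_cong[THEN iffD1, rotated]) (auto simp: j_def F_mult)
    ultimately show ?case
      using inj insert.hyps unfolding S'_def[symmetric] img[symmetric]
      by (simp add: summable_on_reindex has_sum_reindex)
  qed
  then show "(\<lambda>n. norm (F n)) summable_on {n. n > 0 \<and> prime_factors n \<subseteq> P}"
    and "(F has_sum (\<Prod>p\<in>P. s p)) {n. n > 0 \<and> prime_factors n \<subseteq> P}" by auto
qed

lemma smooth_numbers_eq: "smooth_numbers y = {n. n > 0 \<and> prime_factors n \<subseteq> primes_upto y}"
  by (auto simp: smooth_numbers_def primes_upto_def prime_factors_dvd)

section \<open>Binomial series for the local Euler factors\<close>

lemma gbinomial_uminus_power:
  fixes z w :: "'a::field_char_0"
  shows "((- z) gchoose n) * (- w) ^ n = pochhammer z n / fact n * w ^ n"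
proof -
  have "(- 1) ^ n * (- w) ^ n = w ^ n" by (simp flip: power_mult_distrib)
  then show ?thesis by (simp add: gbinomial_pochhammer mult.commute mult.left_commute)
qed

text \<open>This is the binomial series of \<open>(1 - x) powr (- z)\<close>. For nonnegative
  \<open>z\<close> and \<open>x\<close> all its terms are nonnegative, so ordinary convergence is
  already unconditional.\<close>

lemma has_sum_pochhammer_real:
  fixes z x :: real
  assumes "0 \<le> z" "0 \<le> x" "x < 1"
  shows "((\<lambda>n. pochhammer z n / fact n * x ^ n) has_sum (1 - x) powr (- z)) UNIV"
  using gen_binomial_real[of "- x" "- z"] assms
  by (intro sums_nonneg_imp_has_sum) (simp_all add: gbinomial_uminus_power pochhammer_prod prod_nonneg)

text \<open>The triangle inequality in each factor \<open>z + i\<close>. On divisor coefficients it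
  says that those of \<open>z\<close> are dominated by those of \<open>norm z\<close>.\<close>

lemma norm_pochhammer_le: "norm (pochhammer z n) \<le> pochhammer (norm z) n"
  for z :: "'a::real_normed_field"
  unfolding pochhammer_prod prod_norm[symmetric]
  using norm_triangle_ineq[of z "of_nat _"] by (intro prod_mono) simp

text \<open>Comparison with the real series at \<open>norm z\<close> and \<open>norm w\<close> gives
  absolute convergence and the bound on the sum of norms; the value comes from the complex binomial
  series.\<close>

lemma has_sum_pochhammer_complex:
  fixes z w :: complex
  assumes "norm w < 1"
  shows "(\<lambda>n. norm (pochhammer z n / fact n * w ^ n)) summable_on UNIV"
    and "((\<lambda>n. pochhammer z n / fact n * w ^ n) has_sum (1 - w) powr (- z)) UNIV"
    and "(\<Sum>\<^sub>\<infinity>n. norm (pochhammer z n / fact n * w ^ n)) \<le> (1 - norm w) powr (- norm z)"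
proof -
  have r: "((\<lambda>n. pochhammer (norm z) n / fact n * norm w ^ n) has_sum (1 - norm w) powr (- norm z)) UNIV"
    using assms by (intro has_sum_pochhammer_real) auto
  have le: "norm (pochhammer z n / fact n * w ^ n) \<le> pochhammer (norm z) n / fact n * norm w ^ n" for n
    by (auto simp: norm_mult norm_divide norm_power intro!: mult_right_mono divide_right_mono norm_pochhammer_le)
  show s: "(\<lambda>n. norm (pochhammer z n / fact n * w ^ n)) summable_on UNIV"
    by (rule summable_on_comparison_test[OF has_sum_imp_summable[OF r]]) (use le in auto)
  have "summable (\<lambda>n. norm (pochhammer z n / fact n * w ^ n))"
    by (rule summable_on_imp_summable[OF s])
  moreover have "(\<lambda>n. pochhammer z n / fact n * w ^ n) sums (1 - w) powr (- z)"
    using gen_binomial_complex[of "- w" "- z"] assms by (simp add: gbinomial_uminus_power)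
  ultimately show "((\<lambda>n. pochhammer z n / fact n * w ^ n) has_sum (1 - w) powr (- z)) UNIV"
    by (rule norm_summable_imp_has_sum)
  show "(\<Sum>\<^sub>\<infinity>n. norm (pochhammer z n / fact n * w ^ n)) \<le> (1 - norm w) powr (- norm z)"
    using infsum_mono[OF s has_sum_imp_summable[OF r] le] infsumI[OF r] by simp
qed

subsection \<open>Dirichlet series of complex powers\<close>

lemma completely_multiplicative_power:
  assumes "completely_multiplicative f" "n > 0"
  shows "f (n ^ k) = f n ^ k"
  by (induction k) (use assms in \<open>auto simp: completely_multiplicative_def Suc_le_eq\<close>)

lemma completely_multiplicative_prod:
  assumes "completely_multiplicative f" "\<And>x. x \<in> A \<Longrightarrow> h x > 0"
  shows "f (\<Prod>x\<in>A. h x) = (\<Prod>x\<in>A. f (h x))"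
proof (cases "finite A")
  case True
  then show ?thesis using assms(2)
  proof (induction A)
    case (insert x A)
    then have "h x \<ge> 1" "(\<Prod>x\<in>A. h x) \<ge> 1" by (auto simp: Suc_le_eq intro!: prod_pos)
    then show ?case using insert assms(1) by (auto simp: completely_multiplicative_def)
  qed (use assms(1) in \<open>simp add: completely_multiplicative_def\<close>)
qed (use assms(1) in \<open>simp add: completely_multiplicative_def\<close>)

lemma completely_multiplicative_prime_factors:
  assumes "completely_multiplicative f" "n > 0"
  shows "f n = (\<Prod>p\<in>prime_factors n. f p ^ multiplicity p n)"
proof -
  have "f n = f (\<Prod>p\<in>prime_factors n. p ^ multiplicity p n)"
    using prime_factorization_nat[OF assms(2)] by simp
  also have "\<dots> = (\<Prod>p\<in>prime_factors n. f (p ^ multiplicity p n))"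
    by (rule completely_multiplicative_prod[OF assms(1)])
       (use prime_gt_0_nat in_prime_factors_imp_prime in \<open>blast intro: zero_less_power\<close>)
  also have "\<dots> = (\<Prod>p\<in>prime_factors n. f p ^ multiplicity p n)"
    by (intro prod.cong refl completely_multiplicative_power[OF assms(1)])
       (use prime_gt_0_nat in_prime_factors_imp_prime in blast)
  finally show ?thesis .
qed

lemma of_nat_powr_eq_exp: "n > 0 \<Longrightarrow> (of_nat n :: complex) powr s = exp (s * of_real (ln (real n)))"
  by (simp add: powr_def)

text \<open>Logarithms of positive integers are real and additive, so \<open>of_nat n powr s\<close>
  is multiplicative for every complex \<open>s\<close> without any branch issue. The Euler product
  can therefore be stated for a single function \<open>g\<close>.\<close>

lemma completely_multiplicative_twist:
  assumes "completely_multiplicative f"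
  shows "completely_multiplicative (\<lambda>n. f n / of_nat n powr s)"
proof -
  have "of_nat (m * n) powr s = (of_nat m powr s * of_nat n powr s :: complex)"
    if "m \<ge> 1" "n \<ge> 1" for m n :: nat
    using that of_nat_powr_eq_exp[of m s] of_nat_powr_eq_exp[of n s]
    by (subst of_nat_powr_eq_exp) (auto simp: ln_mult ring_distribs exp_add)
  then show ?thesis using assms
    by (simp add: completely_multiplicative_def)
qed

lemma completely_multiplicative_cnj:
  "completely_multiplicative f \<Longrightarrow> completely_multiplicative (\<lambda>n. cnj (f n))"
  by (simp add: completely_multiplicative_def)

text \<open>The Euler product applied to the local terms
  \<open>pochhammer z a / fact a * g p ^ a\<close>, each of whose series is a binomial
  series.\<close>

lemma divisor_fun_series:
  fixes z :: complex
  assumes g: "completely_multiplicative g" and lt: "\<And>p. p \<in> primes_upto y \<Longrightarrow> norm (g p) < 1"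
  shows "(\<lambda>n. norm (divisor_fun z n * g n)) summable_on smooth_numbers y"
    and "((\<lambda>n. divisor_fun z n * g n) has_sum (\<Prod>p\<in>primes_upto y. (1 - g p) powr (- z)))
           (smooth_numbers y)"
    and "(\<Sum>\<^sub>\<infinity>n\<in>smooth_numbers y. norm (divisor_fun z n * g n))
           \<le> (\<Prod>p\<in>primes_upto y. (1 - norm (g p)) powr (- norm z))"
proof -
  define c where "c = (\<lambda>p a. pochhammer z a / fact a * g p ^ a)"
  define F where "F = (\<lambda>n. \<Prod>p\<in>prime_factors n. c p (multiplicity p n))"
  have F: "F n = divisor_fun z n * g n" if "n \<in> smooth_numbers y" for n
    using completely_multiplicative_prime_factors[OF g, of n] that
    by (simp add: F_def c_def divisor_fun_def divisor_coeff_eq_pochhammer smooth_numbers_def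
        flip: prod.distrib)
  have prime: "prime p" if "p \<in> primes_upto y" for p
    using that by (simp add: primes_upto_def)
  have c0: "c p 0 = 1" for p by (simp add: c_def)
  have s: "(\<lambda>a. norm (c p a)) summable_on UNIV"
          "(c p has_sum (1 - g p) powr (- z)) UNIV"
          "(\<Sum>\<^sub>\<infinity>a. norm (c p a)) \<le> (1 - norm (g p)) powr (- norm z)"
    if "p \<in> primes_upto y" for p
    using has_sum_pochhammer_complex[OF lt[OF that], of z] by (simp_all add: c_def)
  note E = finite_Euler_product[where c = c, OF finite_primes_upto prime c0 s(1) s(2),
             folded smooth_numbers_eq]
  have n0: "norm (c p 0) = 1" for p by (simp add: c0)
  have ns: "((\<lambda>a. norm (c p a)) has_sum (\<Sum>\<^sub>\<infinity>a. norm (c p a))) UNIV" if "p \<in> primes_upto y" for p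
    using s(1)[OF that] by simp
  have ns': "(\<lambda>a. norm (norm (c p a))) summable_on UNIV" if "p \<in> primes_upto y" for p
    using s(1)[OF that] by simp
  \<comment> \<open>The norm of \<open>F n\<close> is the product of the norms of its local terms,
    so the sum of norms is itself an Euler product and can be bounded one prime at a time.\<close>
  have En: "((\<lambda>n. norm (F n)) has_sum (\<Prod>p\<in>primes_upto y. \<Sum>\<^sub>\<infinity>a. norm (c p a))) (smooth_numbers y)"
    using finite_Euler_product(2)[where c = "\<lambda>p a. norm (c p a)", OF finite_primes_upto prime n0 ns' ns]
    by (simp add: smooth_numbers_eq F_def prod_norm)
  have "(\<lambda>n. norm (F n)) summable_on smooth_numbers y"
    using E(1) unfolding F_def .
  then show "(\<lambda>n. norm (divisor_fun z n * g n)) summable_on smooth_numbers y"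
    by (rule summable_on_cong[THEN iffD1, rotated]) (simp add: F)
  have "(F has_sum (\<Prod>p\<in>primes_upto y. (1 - g p) powr (- z))) (smooth_numbers y)"
    using E(2) unfolding F_def .
  then show "((\<lambda>n. divisor_fun z n * g n) has_sum (\<Prod>p\<in>primes_upto y. (1 - g p) powr (- z)))
           (smooth_numbers y)"
    by (rule has_sum_cong[THEN iffD1, rotated]) (simp add: F)
  have "(\<Sum>\<^sub>\<infinity>n\<in>smooth_numbers y. norm (divisor_fun z n * g n)) = (\<Sum>\<^sub>\<infinity>n\<in>smooth_numbers y. norm (F n))"
    by (intro infsum_cong) (simp add: F)
  also have "\<dots> = (\<Prod>p\<in>primes_upto y. \<Sum>\<^sub>\<infinity>a. norm (c p a))"
    by (rule infsumI[OF En])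
  also have "\<dots> \<le> (\<Prod>p\<in>primes_upto y. (1 - norm (g p)) powr (- norm z))"
    by (intro prod_mono conjI infsum_nonneg s(3)) auto
  finally show "(\<Sum>\<^sub>\<infinity>n\<in>smooth_numbers y. norm (divisor_fun z n * g n))
           \<le> (\<Prod>p\<in>primes_upto y. (1 - norm (g p)) powr (- norm z))" .
qed

lemma norm_div_nat_powr:
  assumes "norm (f p) = 1" "p > 0"
  shows "norm (f p / of_nat p powr s) = real p powr (- Re s)"
  using assms by (simp add: norm_divide norm_powr_real_powr powr_minus inverse_eq_divide)

lemma nat_powr_minus_less_1: "p > 1 \<Longrightarrow> \<sigma> > 0 \<Longrightarrow> real p powr (- \<sigma>) < 1"
  by (simp add: powr_minus divide_simps)

lemma primes_upto_gt_1: "p \<in> primes_upto y \<Longrightarrow> p > 1"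
  using prime_gt_1_nat by (auto simp: primes_upto_def)

text \<open>Because \<open>log_L\<close> is a sum of principal logarithms, its exponential splits
  into principal powers of the single factors, which are exactly the values of the binomial
  series.\<close>

lemma L_power_series:
  assumes f: "completely_multiplicative f" "\<And>n. n \<ge> 1 \<Longrightarrow> norm (f n) = 1" and s: "Re s > 0"
  shows "L_power f s y z = (\<Sum>\<^sub>\<infinity>n\<in>smooth_numbers y. divisor_fun z n * (f n / of_nat n powr s))"
proof -
  define g where "g = (\<lambda>n. f n / of_nat n powr s)"
  have lt: "norm (g p) < 1" if "p \<in> primes_upto y" for p
    using primes_upto_gt_1[OF that] s f(2)[of p]
    unfolding g_def by (subst norm_div_nat_powr) (auto intro: nat_powr_minus_less_1)
  have "L_power f s y z = (\<Prod>p\<in>primes_upto y. exp (z * - Ln (1 - g p)))"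
    by (simp add: L_power_def log_L_def g_def sum_distrib_left exp_sum finite_primes_upto)
  \<comment> \<open>The bound \<open>norm (g p) < 1\<close> keeps the base nonzero; at base
    \<open>0\<close> the function \<open>powr\<close> takes the default value \<open>0\<close>
    instead of an exponential.\<close>
  also have "\<dots> = (\<Prod>p\<in>primes_upto y. (1 - g p) powr (- z))"
    using lt by (intro prod.cong) (fastforce simp: powr_def)+
  also have "\<dots> = (\<Sum>\<^sub>\<infinity>n\<in>smooth_numbers y. divisor_fun z n * g n)"
    using infsumI[OF divisor_fun_series(2)[of g y z]] completely_multiplicative_twist[OF f(1)] lt
    by (simp add: g_def)
  finally show ?thesis by (simp add: g_def)
qed

text \<open>Each Euler factor \<open>1 - f p / of_nat p powr s\<close> has positive real part, hence
  avoids the branch cut, and there conjugation commutes with \<open>Ln\<close>. The conjugate power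
  thus has the same kind of series as \<open>L_power\<close>.\<close>

lemma cnj_L_power_eq:
  assumes "\<And>n. n \<ge> 1 \<Longrightarrow> norm (f n) = 1" "Re s > 0"
  shows "cnj_L_power f s y z = L_power (\<lambda>n. cnj (f n)) (cnj s) y z"
proof -
  have "cnj (Ln (1 - f p / of_nat p powr s)) = Ln (1 - cnj (f p) / of_nat p powr cnj s)"
    if "p \<in> primes_upto y" for p
  proof -
    have p: "p > 1" by (rule primes_upto_gt_1[OF that])
    have "norm (f p / of_nat p powr s) < 1"
      using p assms by (subst norm_div_nat_powr) (auto intro: nat_powr_minus_less_1)
    then have "1 - Re (f p / of_nat p powr s) > 0"
      using complex_Re_le_cmod[of "f p / of_nat p powr s"] by linarith
    then have "1 - f p / of_nat p powr s \<notin> \<real>\<^sub>\<le>\<^sub>0"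
      by (auto simp: complex_nonpos_Reals_iff)
    then show ?thesis using p by (simp add: cnj_Ln of_nat_powr_eq_exp exp_cnj)
  qed
  then show ?thesis
    by (simp add: cnj_L_power_def L_power_def log_L_def)
qed

text \<open>The weight \<open>real n powr \<delta>\<close> is absorbed into a twist by exponent
  \<open>1 - \<delta>\<close>, as in Rankin's trick; \<open>\<delta> < 1\<close> keeps the twisted
  values at primes below \<open>1\<close> in norm.\<close>

lemma divisor_fun_series_bound:
  assumes f: "completely_multiplicative f" "\<And>n. n \<ge> 1 \<Longrightarrow> norm (f n) = 1" and "\<delta> < 1"
  shows "(\<lambda>n. norm (divisor_fun z n * f n / of_nat n) * real n powr \<delta>) summable_on smooth_numbers y"
    and "(\<Sum>\<^sub>\<infinity>n\<in>smooth_numbers y. norm (divisor_fun z n * f n / of_nat n) * real n powr \<delta>)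
           \<le> (\<Prod>p\<in>primes_upto y. (1 - real p powr (\<delta> - 1)) powr (- norm z))"
proof -
  define g where "g = (\<lambda>n. f n / of_nat n powr (of_real (1 - \<delta>) :: complex))"
  have ng: "norm (g p) = real p powr (\<delta> - 1)" if "p \<ge> 1" for p
    using that f(2)[of p] unfolding g_def by (subst norm_div_nat_powr) auto
  have lt: "norm (g p) < 1" if "p \<in> primes_upto y" for p
    using primes_upto_gt_1[OF that] assms(3) nat_powr_minus_less_1[of p "1 - \<delta>"] by (simp add: ng)
  have eq: "norm (divisor_fun z n * g n) = norm (divisor_fun z n * f n / of_nat n) * real n powr \<delta>"
    if "n \<in> smooth_numbers y" for n
    using that f(2)[of n] ng[of n]
    by (simp add: smooth_numbers_def norm_mult norm_divide powr_diff)
  have cg: "completely_multiplicative g"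
    unfolding g_def by (rule completely_multiplicative_twist[OF f(1)])
  note D = divisor_fun_series[OF cg lt, of y z]
  show "(\<lambda>n. norm (divisor_fun z n * f n / of_nat n) * real n powr \<delta>) summable_on smooth_numbers y"
    using D(1) by (rule summable_on_cong[THEN iffD1, rotated]) (auto simp: eq)
  have "(\<Sum>\<^sub>\<infinity>n\<in>smooth_numbers y. norm (divisor_fun z n * f n / of_nat n) * real n powr \<delta>)
      = (\<Sum>\<^sub>\<infinity>n\<in>smooth_numbers y. norm (divisor_fun z n * g n))"
    by (intro infsum_cong) (simp add: eq)
  also have "\<dots> \<le> (\<Prod>p\<in>primes_upto y. (1 - norm (g p)) powr (- norm z))"
    using D(3) by simp
  also have "\<dots> = (\<Prod>p\<in>primes_upto y. (1 - real p powr (\<delta> - 1)) powr (- norm z))"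
    by (intro prod.cong refl) (metis ng primes_upto_gt_1 less_imp_le)
  finally show "(\<Sum>\<^sub>\<infinity>n\<in>smooth_numbers y. norm (divisor_fun z n * f n / of_nat n) * real n powr \<delta>)
           \<le> (\<Prod>p\<in>primes_upto y. (1 - real p powr (\<delta> - 1)) powr (- norm z))" .
qed

subsection \<open>Mean values\<close>

text \<open>For \<open>m < n\<close>, the inequality \<open>ln u \<le> u - 1\<close> at
  \<open>u = m / n\<close> gives a gap of at least \<open>(n - m) / n\<close>, and
  \<open>m * (n - m)\<close> is at least \<open>1\<close>.\<close>

lemma abs_ln_diff_nat_ge:
  fixes m n :: nat
  assumes "m > 0" "n > 0" "m \<noteq> n"
  shows "1 \<le> real m * real n * \<bar>ln (real n) - ln (real m)\<bar>"
proof -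
  have *: "1 \<le> real m * real n * (ln (real n) - ln (real m))" if "0 < m" "m < n" for m n :: nat
  proof -
    have "ln (real m / real n) \<le> real m / real n - 1"
      using that by (intro ln_le_minus_one) auto
    then have "(real n - real m) / real n \<le> ln (real n) - ln (real m)"
      using that by (simp add: ln_div diff_divide_distrib)
    then have "real m * real n * ((real n - real m) / real n) \<le> real m * real n * (ln (real n) - ln (real m))"
      by (intro mult_left_mono) auto
    moreover have "1 * 1 \<le> real m * (real n - real m)"
      using that by (intro mult_mono) auto
    moreover have "real m * real n * ((real n - real m) / real n) = real m * (real n - real m)"
      using that by simp
    ultimately show ?thesis by linarith
  qed
  show ?thesis
  proof (cases "m < n")
    case True
    then have "ln (real n) \<ge> ln (real m)" using assms by simp
    then show ?thesis using *[OF assms(1) True] by simp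
  next
    case False
    then have "n < m" using assms by simp
    moreover from this have "ln (real m) \<ge> ln (real n)" using assms by simp
    ultimately show ?thesis using *[OF assms(2), of m] by (simp add: mult.commute)
  qed
qed

text \<open>The antiderivative \<open>exp (\<i> l t) / (\<i> l)\<close> has modulus
  \<open>1 / \<bar>l\<bar>\<close> at both endpoints.\<close>

lemma norm_integral_exp_le:
  fixes l T :: real
  assumes "l \<noteq> 0" "T > 0"
  shows "norm (integral {T..2*T} (\<lambda>t. exp (\<i> * of_real (l * t)))) \<le> 2 / \<bar>l\<bar>"
proof -
  define F where "F = (\<lambda>t. exp (\<i> * of_real (l * t)) / (\<i> * of_real l))"
  have "((\<lambda>t. exp (\<i> * of_real (l * t))) has_integral (F (2 * T) - F T)) {T..2*T}"
  proof (rule fundamental_theorem_of_calculus)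
    fix t assume "t \<in> {T..2*T}"
    have "((\<lambda>z. exp (\<i> * of_real l * z) / (\<i> * of_real l)) has_field_derivative exp (\<i> * of_real l * of_real t)) (at (of_real t))"
      using assms by (auto intro!: derivative_eq_intros)
    from has_vector_derivative_real_field[OF this]
    show "(F has_vector_derivative exp (\<i> * of_real (l * t))) (at t within {T..2*T})"
      unfolding F_def by (simp add: mult.assoc has_vector_derivative_at_within)
  qed (use assms in auto)
  then have "integral {T..2*T} (\<lambda>t. exp (\<i> * of_real (l * t))) = F (2 * T) - F T"
    by (rule integral_unique)
  moreover have "norm (F t) = 1 / \<bar>l\<bar>" for t
    by (simp add: F_def norm_divide norm_mult)
  ultimately show ?thesis
    using norm_triangle_ineq4[of "F (2*T)" "F T"] by simp
qed

text \<open>On the diagonal the mean is exactly \<open>1\<close>. Off it there are two bounds,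
  \<open>1\<close> from the length of the interval and \<open>X = 2 * m * n / T\<close> from
  oscillation, and the smaller of \<open>1\<close> and \<open>X\<close> is at most
  \<open>X powr \<delta>\<close>. The power form matters because it factors into a part in
  \<open>m\<close> and a part in \<open>n\<close>.\<close>

lemma norm_mean_exp_le:
  fixes m n :: nat and T \<delta> :: real
  assumes "m > 0" "n > 0" "T > 0" "0 \<le> \<delta>" "\<delta> \<le> 1"
  shows "norm (of_real (1 / T) * integral {T..2*T} (\<lambda>t. exp (\<i> * of_real ((ln (real n) - ln (real m)) * t)))
            - (if m = n then 1 else 0)) \<le> (2 / T) powr \<delta> * (real m powr \<delta> * real n powr \<delta>)"
proof (cases "m = n")
  case True
  then have "integral {T..2*T} (\<lambda>t. exp (\<i> * of_real ((ln (real n) - ln (real m)) * t))) = of_real T"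
    using assms(3) by (simp add: scaleR_conv_of_real)
  then show ?thesis using True assms(3) by simp
next
  case False
  define l where "l = ln (real n) - ln (real m)"
  have l: "l \<noteq> 0" using False assms by (simp add: l_def)
  define I where "I = of_real (1 / T) * integral {T..2*T} (\<lambda>t. exp (\<i> * of_real (l * t)))"
  define X where "X = 2 / T * (real m * real n)"
  have X: "X > 0" using assms by (simp add: X_def)
  have "norm (integral {T..2*T} (\<lambda>t. exp (\<i> * of_real (l * t)))) \<le> 1 * (2 * T - T)"
    using assms(3) by (intro integral_bound) (auto intro!: continuous_intros)
  then have I1: "norm I \<le> 1" using assms(3) by (simp add: I_def norm_mult norm_divide)
  have "1 / \<bar>l\<bar> \<le> real m * real n"
    using abs_ln_diff_nat_ge[OF assms(1,2) False] l by (simp add: l_def field_simps)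
  then have "norm (integral {T..2*T} (\<lambda>t. exp (\<i> * of_real (l * t)))) \<le> 2 * (real m * real n)"
    using norm_integral_exp_le[OF l assms(3)] by simp
  then have "norm I \<le> 1 / T * (2 * (real m * real n))"
    using assms(3) unfolding I_def norm_mult by (intro mult_mono) (auto simp: norm_divide)
  then have IX: "norm I \<le> X" by (simp add: X_def)
  have "norm I \<le> X powr \<delta>"
  proof (cases "X \<ge> 1")
    case True
    then show ?thesis using I1 ge_one_powr_ge_zero[OF True assms(4)] by linarith
  next
    case False
    then have "X powr 1 \<le> X powr \<delta>"
      using X assms by (intro powr_mono') auto
    then show ?thesis using IX X by simp
  qed
  also have "X powr \<delta> = (2 / T) powr \<delta> * (real m powr \<delta> * real n powr \<delta>)"
    unfolding X_def using assms(3) by (simp only: powr_mult)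
  finally show ?thesis
    using False by (simp add: I_def l_def)
qed

text \<open>The product of the two series is integrated term by term, the diagonal is subtracted,
  and each remaining mean is bounded by a product of a function of \<open>m\<close> and a function
  of \<open>n\<close>, so the majorant sums to a product of two weighted series.\<close>

lemma mean_value_Dirichlet_product:
  fixes a b :: "nat \<Rightarrow> complex" and T \<delta> :: real
  assumes pos: "\<And>n. n \<in> S \<Longrightarrow> n > 0" and T: "T > 0" and \<delta>: "0 \<le> \<delta>" "\<delta> \<le> 1"
    and a: "(\<lambda>n. norm (a n) * real n powr \<delta>) summable_on S"
    and b: "(\<lambda>n. norm (b n) * real n powr \<delta>) summable_on S"
  defines "G \<equiv> \<lambda>t. (\<Sum>\<^sub>\<infinity>m\<in>S. a m * exp (- (\<i> * of_real (ln (real m) * t)))) *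
                   (\<Sum>\<^sub>\<infinity>n\<in>S. b n * exp (\<i> * of_real (ln (real n) * t)))"
  shows "(\<lambda>n. a n * b n) summable_on S"
    and "norm (of_real (1 / T) * integral {T..2*T} G - (\<Sum>\<^sub>\<infinity>n\<in>S. a n * b n))
          \<le> (2 / T) powr \<delta> * (\<Sum>\<^sub>\<infinity>n\<in>S. norm (a n) * real n powr \<delta>) *
             (\<Sum>\<^sub>\<infinity>n\<in>S. norm (b n) * real n powr \<delta>)"
proof -
  \<comment> \<open>Weights of at least \<open>1\<close> turn the weighted summability hypotheses
    into plain absolute summability.\<close>
  have ge1: "real n powr \<delta> \<ge> 1" if "n \<in> S" for n
    using pos[OF that] \<delta> by (intro ge_one_powr_ge_zero) auto
  have na: "(\<lambda>n. norm (a n)) summable_on S"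
    by (rule summable_on_comparison_test[OF a]) (use ge1 in \<open>auto intro!: mult_right_le_one_le simp: mult_le_cancel_left1\<close>)
  have nb: "(\<lambda>n. norm (b n)) summable_on S"
    by (rule summable_on_comparison_test[OF b]) (use ge1 in \<open>auto simp: mult_le_cancel_left1\<close>)
  define e where "e = (\<lambda>(m::nat) (n::nat) t. exp (\<i> * of_real ((ln (real n) - ln (real m)) * t)))"
  define h where "h = (\<lambda>(m,n) t. a m * b n * e m n t)"
  define c where "c = (\<lambda>(m,n). integral {T..2*T} (h (m,n)))"
  \<comment> \<open>The diagonal is extended by zero, so that main term and mean value are sums over
    the same index set and can be subtracted termwise.\<close>
  define D where "D = (\<lambda>(m,n). if m = n then a m * b n else 0)"
  have ne: "norm (e m n t) = 1" for m n t by (simp add: e_def)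
  have norms: "(\<lambda>(m,n). norm (a m * b n)) summable_on S \<times> S"
    by (rule has_sum_Times_abs(1)[OF na nb has_sum_infsum has_sum_infsum])
       (rule abs_summable_summable, rule na nb)+
  have hG: "(\<lambda>x. \<Sum>\<^sub>\<infinity>p\<in>S\<times>S. h p x) = G"
  proof
    fix t
    have na': "(\<lambda>m. norm (a m * exp (- (\<i> * of_real (ln (real m) * t))))) summable_on S"
      using na by (simp add: norm_mult)
    have nb': "(\<lambda>m. norm (b m * exp (\<i> * of_real (ln (real m) * t)))) summable_on S"
      using nb by (simp add: norm_mult)
    have "((\<lambda>(m,n). a m * exp (- (\<i> * of_real (ln (real m) * t))) * (b n * exp (\<i> * of_real (ln (real n) * t))))
        has_sum G t) (S \<times> S)"
      unfolding G_def
      by (rule has_sum_Times_abs(2)[OF na' nb' has_sum_infsum has_sum_infsum])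
         (rule abs_summable_summable, rule na' nb')+
    moreover have "a m * exp (- (\<i> * of_real (ln (real m) * t))) * (b n * exp (\<i> * of_real (ln (real n) * t))) = h (m,n) t" for m n
    proof -
      have "e m n t = exp (- (\<i> * of_real (ln (real m) * t)) + \<i> * of_real (ln (real n) * t))"
        unfolding e_def by (rule arg_cong[of _ _ exp]) (simp add: algebra_simps)
      then show ?thesis by (simp only: h_def exp_add prod.case mult_ac)
    qed
    ultimately show "(\<Sum>\<^sub>\<infinity>p\<in>S\<times>S. h p t) = G t"
      by (simp add: case_prod_unfold infsumI)
  qed
  \<comment> \<open>The exponentials are unimodular, so the coefficient norms form a majorant
    independent of \<open>t\<close>; uniform convergence then permits the exchange of sum and
    integral.\<close>
  have "uniform_limit {T..2*T} (\<lambda>X t. \<Sum>p\<in>X. h p t) (\<lambda>t. \<Sum>\<^sub>\<infinity>p\<in>S\<times>S. h p t)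
          (finite_subsets_at_top (S \<times> S))"
    by (rule Weierstrass_m_test_general[OF _ norms]) (auto simp: h_def norm_mult ne)
  note ul = this
  have cont: "continuous_on A (h p)" for p A
    by (cases p) (auto simp: h_def e_def intro!: continuous_intros)
  obtain I J where I: "\<And>X. ((\<lambda>t. \<Sum>p\<in>X. h p t) has_integral I X) {T..2*T}"
    and J: "((\<lambda>t. \<Sum>\<^sub>\<infinity>p\<in>S\<times>S. h p t) has_integral J) {T..2*T}"
    and lim: "(I \<longlongrightarrow> J) (finite_subsets_at_top (S \<times> S))"
    by (rule uniform_limit_integral[OF ul continuous_on_sum[OF cont]]) auto
  have JG: "integral {T..2*T} G = J" using J by (auto simp: hG intro: integral_unique)
  have "I = sum c"
  proof
    fix X
    have "I X = integral {T..2*T} (\<lambda>t. \<Sum>p\<in>X. h p t)"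
      using I[of X] by (simp add: integral_unique)
    also have "\<dots> = (\<Sum>p\<in>X. integral {T..2*T} (h p))"
      by (cases "finite X") (auto intro!: integral_sum integrable_continuous_interval cont)
    finally show "I X = sum c X" by (simp add: c_def case_prod_unfold)
  qed
  with lim have cJ: "(c has_sum J) (S \<times> S)"
    by (simp add: has_sum_def)
  have "(\<lambda>(m,n). a m * b n) summable_on S \<times> S"
    by (rule abs_summable_summable) (use norms in \<open>simp add: case_prod_unfold\<close>)
  then have "(\<lambda>(m,n). a m * b n) summable_on (\<lambda>n. (n,n)) ` S"
    by (rule summable_on_subset) auto
  then show sab: "(\<lambda>n. a n * b n) summable_on S"
    by (subst (asm) summable_on_reindex) (auto simp: inj_on_def o_def)
  then have "(((\<lambda>(m,n). a m * b n) \<circ> (\<lambda>n. (n,n))) has_sum (\<Sum>\<^sub>\<infinity>n\<in>S. a n * b n)) S"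
    by (simp add: o_def)
  then have "((\<lambda>(m,n). a m * b n) has_sum (\<Sum>\<^sub>\<infinity>n\<in>S. a n * b n)) ((\<lambda>n. (n,n)) ` S)"
    by (subst has_sum_reindex) (auto simp: inj_on_def)
  then have D: "(D has_sum (\<Sum>\<^sub>\<infinity>n\<in>S. a n * b n)) (S \<times> S)"
    by (rule has_sum_cong_neutral[THEN iffD1, rotated -1]) (auto simp: D_def)
  have diff: "((\<lambda>p. of_real (1 / T) * c p - D p) has_sum (of_real (1 / T) * J - (\<Sum>\<^sub>\<infinity>n\<in>S. a n * b n))) (S \<times> S)"
    using has_sum_add[OF has_sum_cmult_right[OF cJ] has_sum_uminusI[OF D], of "of_real (1 / T)"] by simp
  define A B where "A = (\<Sum>\<^sub>\<infinity>n\<in>S. norm (a n) * real n powr \<delta>)" and "B = (\<Sum>\<^sub>\<infinity>n\<in>S. norm (b n) * real n powr \<delta>)"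
  have "((\<lambda>(m,n). (norm (a m) * real m powr \<delta>) * (norm (b n) * real n powr \<delta>)) has_sum A * B) (S \<times> S)"
    unfolding A_def B_def using a b by (intro has_sum_Times_abs has_sum_infsum) auto
  from has_sum_cmult_right[OF this, of "(2 / T) powr \<delta>"]
  have maj: "((\<lambda>p. (2 / T) powr \<delta> * (case p of (m,n) \<Rightarrow> (norm (a m) * real m powr \<delta>) * (norm (b n) * real n powr \<delta>)))
     has_sum (2 / T) powr \<delta> * A * B) (S \<times> S)"
    by (simp add: mult.assoc)
  show "norm (of_real (1 / T) * integral {T..2*T} G - (\<Sum>\<^sub>\<infinity>n\<in>S. a n * b n))
          \<le> (2 / T) powr \<delta> * (\<Sum>\<^sub>\<infinity>n\<in>S. norm (a n) * real n powr \<delta>) *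
             (\<Sum>\<^sub>\<infinity>n\<in>S. norm (b n) * real n powr \<delta>)"
    unfolding JG A_def[symmetric] B_def[symmetric]
  proof (rule norm_infsum_le[OF diff maj])
    fix p assume "p \<in> S \<times> S"
    then obtain m n where p: "p = (m,n)" "m > 0" "n > 0" using pos by auto
    have "of_real (1 / T) * c p - D p = a m * b n * (of_real (1 / T) * integral {T..2*T} (e m n) - (if m = n then 1 else 0))"
      by (simp add: p c_def D_def h_def algebra_simps)
    also have "norm \<dots> \<le> norm (a m * b n) * ((2 / T) powr \<delta> * (real m powr \<delta> * real n powr \<delta>))"
      unfolding norm_mult[of "a m * b n"] e_def
      by (intro mult_left_mono norm_mean_exp_le p T \<delta>) auto
    finally show "norm (of_real (1 / T) * c p - D p)
        \<le> (2 / T) powr \<delta> * (case p of (m,n) \<Rightarrow> (norm (a m) * real m powr \<delta>) * (norm (b n) * real n powr \<delta>))"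
      by (simp add: p norm_mult mult_ac)
  qed
qed

subsection \<open>Sums over primes\<close>

text \<open>The sequence \<open>harm n - ln n\<close> decreases from its value \<open>1\<close> at
  \<open>n = 1\<close>.\<close>

lemma harm_le_ln: "n \<ge> 1 \<Longrightarrow> harm n \<le> 1 + ln (real n)"
  using euler_mascheroni_sequence_decreasing[of 1 n] by (simp add: harm_def)

lemma prod_primes_dvd:
  fixes n :: nat
  assumes "finite A" "\<And>p. p \<in> A \<Longrightarrow> prime p" "\<And>p. p \<in> A \<Longrightarrow> p dvd n"
  shows "\<Prod>A dvd n"
  using assms
proof (induction A)
  case (insert p A)
  have "coprime p (\<Prod>A)"
    using insert by (intro prod_coprime_right primes_coprime) auto
  then show ?case using insert by (simp add: divides_mult)
qed simp

text \<open>Chebyshev's argument: every prime in the range divides the central binomial coefficient,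
  because it divides \<open>fact (2 * n)\<close> but not \<open>fact n\<close>; hence their product
  is at most \<open>2 ^ (2 * n)\<close>.\<close>

lemma sum_ln_primes_dyadic:
  "(\<Sum>p | prime p \<and> n < p \<and> p \<le> 2 * n. ln (real p)) \<le> 2 * real n * ln 2"
proof -
  define A where "A = {p. prime p \<and> n < p \<and> p \<le> 2 * n}"
  have fin: "finite A" by (rule finite_subset[of _ "{..2*n}"]) (auto simp: A_def)
  have pr: "prime p" if "p \<in> A" for p using that by (simp add: A_def)
  have "\<Prod>A dvd (2 * n) choose n"
  proof (rule prod_primes_dvd[OF fin])
    fix p assume p: "p \<in> A"
    have "p dvd fact (2 * n)" using p by (auto simp: A_def prime_dvd_fact_iff)
    also have "fact (2 * n) = fact n * fact n * ((2 * n) choose n)"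
      using binomial_fact_lemma[of n "2 * n"] by simp
    finally have "p dvd fact n \<or> p dvd ((2 * n) choose n)"
      using pr[OF p] by (auto simp: prime_dvd_mult_iff)
    moreover have "\<not> p dvd fact n"
      using p by (auto simp: A_def prime_dvd_fact_iff)
    ultimately show "p dvd (2 * n) choose n" by blast
  qed (use pr in auto)
  then have "\<Prod>A \<le> (2 * n) choose n" by (rule dvd_imp_le) simp
  also have "\<dots> \<le> 2 ^ (2 * n)" by (rule binomial_le_pow2)
  finally have le: "real (\<Prod>A) \<le> 2 ^ (2 * n)"
    by (metis of_nat_le_iff of_nat_numeral of_nat_power)
  have pos: "real p > 0" if "p \<in> A" for p
    using pr[OF that] by (simp add: prime_gt_0_nat)
  have "(\<Sum>p\<in>A. ln (real p)) = ln (\<Prod>p\<in>A. real p)"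
    using fin pos by (subst ln_prod) auto
  also have "\<dots> \<le> ln (2 ^ (2 * n))"
    using le pos by (subst ln_le_cancel_iff) (auto intro!: prod_pos)
  also have "\<dots> = 2 * real n * ln 2" by (simp add: ln_realpow)
  finally show ?thesis by (simp add: A_def)
qed

lemma primes_le_pow2_Suc:
  "{p::nat. prime p \<and> p \<le> 2 ^ Suc N} = {p. prime p \<and> p \<le> 2 ^ N} \<union> {p. prime p \<and> 2 ^ N < p \<and> p \<le> 2 * 2 ^ N}"
  by auto

lemma sum_primes_le_pow2_Suc:
  fixes h :: "nat \<Rightarrow> real"
  shows "(\<Sum>p | prime p \<and> p \<le> 2 ^ Suc N. h p)
    = (\<Sum>p | prime p \<and> p \<le> 2 ^ N. h p) + (\<Sum>p | prime p \<and> 2 ^ N < p \<and> p \<le> 2 * 2 ^ N. h p)"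
  unfolding primes_le_pow2_Suc
proof (rule sum.union_disjoint)
  show "finite {p. prime p \<and> p \<le> (2::nat) ^ N}"
    by (rule finite_subset[of _ "{..2 ^ N}"]) auto
  show "finite {p. prime p \<and> 2 ^ N < p \<and> p \<le> 2 * (2::nat) ^ N}"
    by (rule finite_subset[of _ "{..2 * 2 ^ N}"]) auto
qed auto

text \<open>On the block from \<open>2 ^ N\<close> to \<open>2 ^ Suc N\<close> the factor
  \<open>1 / p\<close> is at most \<open>1 / 2 ^ N\<close>, so by the Chebyshev bound each block
  contributes at most \<open>2 * ln 2\<close>.\<close>

lemma sum_ln_over_primes_le:
  "(\<Sum>p | prime p \<and> p \<le> (2::nat) ^ N. ln (real p) / real p) \<le> 2 * ln 2 * real N"
proof (induction N)
  case 0
  have "{p::nat. prime p \<and> p \<le> 2 ^ 0} = {}" by (auto dest: prime_gt_1_nat)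
  then show ?case by (simp only: sum.empty)
next
  case (Suc N)
  have "(\<Sum>p | prime p \<and> 2 ^ N < p \<and> p \<le> 2 * 2 ^ N. ln (real p) / real p)
      \<le> (\<Sum>p | prime p \<and> 2 ^ N < p \<and> p \<le> 2 * 2 ^ N. ln (real p) / 2 ^ N)"
  proof (rule sum_mono)
    fix p :: nat assume "p \<in> {p. prime p \<and> 2 ^ N < p \<and> p \<le> 2 * 2 ^ N}"
    moreover from this have "real (2 ^ N) < real p" unfolding of_nat_less_iff by simp
    ultimately show "ln (real p) / real p \<le> ln (real p) / 2 ^ N"
      by (intro divide_left_mono) (auto dest: prime_gt_0_nat intro: ln_ge_zero)
  qed
  also have "\<dots> \<le> 2 * real (2 ^ N) * ln 2 / 2 ^ N"
    unfolding sum_divide_distrib[symmetric] by (intro divide_right_mono sum_ln_primes_dyadic) auto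
  also have "\<dots> = 2 * ln 2" by simp
  finally show ?case using Suc unfolding sum_primes_le_pow2_Suc by (simp add: algebra_simps)
qed

text \<open>The block above \<open>2 ^ M\<close> contributes at most \<open>2 / M\<close>, since
  there \<open>ln p\<close> is at least \<open>M * ln 2\<close>. The prime \<open>2\<close> lies in
  the block \<open>M = 0\<close>, where this bound is void, and accounts for the separate
  \<open>1 / 2\<close>; the blocks \<open>1\<close> to \<open>N\<close> then produce
  \<open>harm N\<close>.\<close>

lemma sum_inverse_primes_le:
  "(\<Sum>p | prime p \<and> p \<le> (2::nat) ^ Suc N. 1 / real p) \<le> 1 / 2 + 2 * harm N"
proof (induction N)
  case 0
  have "{p::nat. prime p \<and> p \<le> 2 ^ Suc 0} = {2}" by (auto dest!: prime_ge_2_nat)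
  then show ?case by (simp add: harm_def)
next
  case (Suc N)
  define M where "M = Suc N"
  have "(\<Sum>p | prime p \<and> 2 ^ M < p \<and> p \<le> 2 * 2 ^ M. 1 / real p)
      \<le> (\<Sum>p | prime p \<and> 2 ^ M < p \<and> p \<le> 2 * 2 ^ M. ln (real p) / (2 ^ M * (real M * ln 2)))"
  proof (rule sum_mono)
    fix p :: nat assume p: "p \<in> {p. prime p \<and> 2 ^ M < p \<and> p \<le> 2 * 2 ^ M}"
    then have "real (2 ^ M) < real p" unfolding of_nat_less_iff by simp
    then have lt: "2 ^ M < real p" by simp
    then have "ln (2 ^ M) \<le> ln (real p)" by (subst ln_le_cancel_iff) auto
    then have "real M * ln 2 \<le> ln (real p)" by (simp add: ln_realpow)
    moreover have "real M * ln 2 > 0" by (simp add: M_def)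
    ultimately have "1 \<le> ln (real p) / (real M * ln 2)" by (simp only: le_divide_eq_1_pos)
    moreover have "1 / real p \<le> 1 / 2 ^ M" using lt by (intro divide_left_mono) auto
    ultimately have "1 / real p * 1 \<le> 1 / 2 ^ M * (ln (real p) / (real M * ln 2))"
      by (intro mult_mono) auto
    then show "1 / real p \<le> ln (real p) / (2 ^ M * (real M * ln 2))" by simp
  qed
  also have "\<dots> \<le> 2 * real (2 ^ M) * ln 2 / (2 ^ M * (real M * ln 2))"
    unfolding sum_divide_distrib[symmetric] by (intro divide_right_mono sum_ln_primes_dyadic) auto
  also have "\<dots> = 2 / real M" by simp
  finally have "(\<Sum>p | prime p \<and> 2 ^ M < p \<and> p \<le> 2 * 2 ^ M. 1 / real p) \<le> 2 / real M" .
  moreover have "harm (Suc N) = harm N + 1 / real M" by (simp add: harm_Suc M_def divide_inverse)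
  ultimately show ?case using Suc unfolding sum_primes_le_pow2_Suc[of "\<lambda>p. 1 / real p" "Suc N"] M_def by simp
qed

section \<open>Elementary inequalities and the bound for the shifted prime sum\<close>

lemma exp_le_one_plus_mult_exp: "exp x \<le> 1 + x * exp x" for x :: real
proof -
  have "exp x * (1 + - x) \<le> exp x * exp (- x)"
    by (intro mult_left_mono exp_ge_add_one_self) auto
  then show ?thesis by (simp add: algebra_simps flip: exp_add)
qed

text \<open>The factor \<open>4\<close> is the largest value of \<open>1 / (1 - u)\<close> on this
  range, which is wide enough to contain \<open>1 / sqrt 2\<close>, the bound for the values at
  primes.\<close>

lemma minus_ln_one_minus_le:
  fixes u :: real
  assumes "0 \<le> u" "u \<le> 3 / 4"
  shows "- ln (1 - u) \<le> 4 * u"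
proof -
  have "- ln (1 - u) = ln (1 / (1 - u))" using assms by (simp add: ln_div)
  also have "\<dots> \<le> 1 / (1 - u) - 1" using assms by (intro ln_le_minus_one) auto
  also have "\<dots> = u * (1 / (1 - u))" using assms by (simp add: field_simps)
  also have "\<dots> \<le> u * 4" using assms by (intro mult_left_mono) (auto simp: field_simps)
  finally show ?thesis by simp
qed

text \<open>With \<open>x = ln (ln T)\<close> this is a Mertens-type bound for the primes up to \<open>(ln T)\<^sup>2\<close>. On that range
  \<open>p powr (1 / x)\<close> is at most \<open>exp 2\<close>, so shifting the exponent by \<open>1 / x\<close> only costs a constant.\<close>

lemma sum_primes_powr_le:
  fixes x y :: real
  assumes x: "x \<ge> 4" and y: "y \<le> exp (2 * x)"
  shows "(\<Sum>p\<in>primes_upto y. - ln (1 - real p powr (1 / x - 1))) \<le> 8 * ln x + 250"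
proof -
  \<comment> \<open>Chosen so that \<open>2 ^ Suc N\<close> reaches \<open>exp (2 * x)\<close>,
    hence \<open>y\<close>, while \<open>N \<le> 3 * x\<close> keeps the harmonic sum of size
    \<open>ln x\<close>.\<close>
  define N where "N = nat \<lfloor>2 * x / ln 2\<rfloor>"
  define P where "P = {p::nat. prime p \<and> p \<le> 2 ^ Suc N}"
  have ln2: "ln 2 \<ge> (2/3 :: real)" "ln 2 \<le> (1 :: real)" using ln2_ge_two_thirds ln_2_less_1 by auto
  have x2: "2 * x / ln 2 > 1"
    using x ln2 by (simp add: field_simps)
  have N1: "N \<ge> 1" unfolding N_def using x2 by linarith
  have Nle: "real N \<le> 2 * x / ln 2" unfolding N_def using x2 by linarith
  have Nge: "2 * x / ln 2 \<le> real (Suc N)" unfolding N_def using x2 by linarith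
  have "2 * x / ln 2 \<le> 2 * x / (2 / 3)" using x ln2 by (intro divide_left_mono) auto
  then have N3: "real N \<le> 3 * x" using Nle by simp
  have finP: "finite P" by (rule finite_subset[of _ "{..2 ^ Suc N}"]) (auto simp: P_def)
  have "exp (2 * x) \<le> exp (real (Suc N) * ln 2)"
    using Nge ln2 by (simp add: field_simps del: of_nat_Suc)
  also have "\<dots> = 2 ^ Suc N"
    by (simp only: exp_of_nat_mult) simp
  finally have "y \<le> real (2 ^ Suc N)" using y by simp
  then have sub: "primes_upto y \<subseteq> P"
    unfolding primes_upto_def P_def
    by (intro Collect_mono impI conjI) (auto dest: order_trans simp only: of_nat_le_iff)
  have pge: "p \<ge> 2" if "p \<in> primes_upto y" for p
    using that prime_ge_2_nat by (auto simp: primes_upto_def)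
  have termb: "- ln (1 - real p powr (1 / x - 1)) \<le> 4 * (1 / real p + exp 2 / x * (ln (real p) / real p))"
    if p: "p \<in> primes_upto y" for p
  proof -
    have p2: "real p \<ge> 2" using pge[OF p] by simp
    have "real p \<le> exp (2 * x)" using p y by (simp add: primes_upto_def)
    then have "ln (real p) \<le> ln (exp (2 * x))" using p2 by (subst ln_le_cancel_iff) auto
    then have lnp: "0 \<le> ln (real p)" "ln (real p) \<le> 2 * x" using p2 by auto
    define u where "u = real p powr (1 / x - 1)"
    have "u \<le> real p powr (- 1 / 2)"
      unfolding u_def using p2 x by (intro powr_mono) (auto simp: field_simps)
    also have "\<dots> \<le> 2 powr (- 1 / 2)" using p2 by (intro powr_mono2') auto
    also have "\<dots> = 1 / sqrt 2" by (simp add: powr_minus_divide powr_half_sqrt)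
    also have "\<dots> \<le> 3 / 4"
    proof -
      have "4 / 3 \<le> sqrt (2::real)" by (rule real_le_rsqrt) (simp add: power2_eq_square)
      then show ?thesis by (simp add: field_simps)
    qed
    finally have "- ln (1 - u) \<le> 4 * u" by (intro minus_ln_one_minus_le) (auto simp: u_def)
    also have "u \<le> 1 / real p + exp 2 / x * (ln (real p) / real p)"
    proof -
      \<comment> \<open>Here \<open>u = exp v / p\<close> with \<open>v \<le> 2\<close>, so
        \<open>exp v \<le> 1 + v * exp 2\<close> splits \<open>u\<close> into a term for the sum of
        \<open>1 / p\<close> and a term for the sum of \<open>ln p / p\<close>.\<close>
      define v where "v = ln (real p) / x"
      have v: "0 \<le> v" "v \<le> 2" using lnp x by (auto simp: v_def field_simps)
      have "u = exp v / real p"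
        using p2 x unfolding u_def v_def by (simp add: powr_diff) (simp add: powr_def)
      also have "\<dots> \<le> (1 + v * exp 2) / real p"
        using exp_le_one_plus_mult_exp[of v] mult_left_mono[of "exp v" "exp 2" v] v p2
        by (intro divide_right_mono) auto
      also have "\<dots> = 1 / real p + exp 2 / x * (ln (real p) / real p)"
        using p2 x by (simp add: v_def field_simps)
      finally show ?thesis .
    qed
    finally show ?thesis unfolding u_def by simp
  qed
  have "(\<Sum>p\<in>primes_upto y. - ln (1 - real p powr (1 / x - 1)))
     \<le> (\<Sum>p\<in>primes_upto y. 4 * (1 / real p + exp 2 / x * (ln (real p) / real p)))"
    by (rule sum_mono[OF termb])
  also have "\<dots> \<le> (\<Sum>p\<in>P. 4 * (1 / real p + exp 2 / x * (ln (real p) / real p)))"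
    using x by (intro sum_mono2 finP sub mult_nonneg_nonneg add_nonneg_nonneg)
      (auto simp: P_def dest: prime_ge_1_nat)
  also have "\<dots> = 4 * (\<Sum>p\<in>P. 1 / real p) + 4 * exp 2 / x * (\<Sum>p\<in>P. ln (real p) / real p)"
    unfolding distrib_left sum.distrib sum_distrib_left by (simp add: mult.assoc)
  also have "\<dots> \<le> 4 * (1 / 2 + 2 * (1 + ln (3 * x))) + 4 * exp 2 / x * (2 * ln 2 * real (Suc N))"
  proof (intro add_mono mult_left_mono)
    have "harm N \<le> 1 + ln (real N)" by (rule harm_le_ln[OF N1])
    also have "ln (real N) \<le> ln (3 * x)" using N3 N1 x by (subst ln_le_cancel_iff) auto
    finally show "(\<Sum>p\<in>P. 1 / real p) \<le> 1 / 2 + 2 * (1 + ln (3 * x))"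
      using sum_inverse_primes_le[of N] unfolding P_def by simp
  qed (use sum_ln_over_primes_le[of "Suc N"] x in \<open>auto simp: P_def\<close>)
  finally have bound: "(\<Sum>p\<in>primes_upto y. - ln (1 - real p powr (1 / x - 1)))
     \<le> 4 * (1 / 2 + 2 * (1 + ln (3 * x))) + 4 * exp 2 / x * (2 * ln 2 * real (Suc N))" .
  \<comment> \<open>The floor gives \<open>2 * ln 2 * N \<le> 4 * x\<close>, and the extra summand
    \<open>2 * ln 2\<close> from \<open>Suc N\<close> fits into another \<open>x\<close>. The
    division by \<open>x\<close> then leaves a constant.\<close>
  have "4 * exp 2 / x * (2 * ln 2 * real (Suc N)) \<le> 4 * exp 2 / x * (5 * x)"
  proof (intro mult_left_mono)
    have "ln 2 * real N \<le> 2 * x" using Nle ln2 by (simp add: field_simps)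
    then show "2 * ln 2 * real (Suc N) \<le> 5 * x" using ln2 x by (simp add: algebra_simps)
  qed (use x in auto)
  also have "4 * exp 2 / x * (5 * x) = 20 * exp 2" using x by simp
  finally have N_part: "4 * exp 2 / x * (2 * ln 2 * real (Suc N)) \<le> 20 * exp 2" .
  have "exp 2 = exp 1 * exp (1::real)" by (simp flip: exp_add)
  also have "\<dots> \<le> 3 * 3" using exp_le by (intro mult_mono) auto
  finally have "exp 2 \<le> (9::real)" by simp
  moreover have "ln (3 * x) = ln 3 + ln x" using x by (simp add: ln_mult)
  moreover have "ln 3 \<le> (2 :: real)" using ln_le_minus_one[of 3] by simp
  \<comment> \<open>The constants add up to \<open>10 + 16 + 180 = 206\<close>, below
    \<open>250\<close>.\<close>
  moreover have "4 * (1 / 2 + 2 * (1 + l)) + 20 * e \<le> 8 * m + 250"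
    if "e \<le> 9" "l = k + m" "k \<le> 2" for e k l m :: real
    using that by simp
  ultimately have "4 * (1 / 2 + 2 * (1 + ln (3 * x))) + 20 * exp 2 \<le> 8 * ln x + 250" by blast
  with order_trans[OF bound add_left_mono[OF N_part]] show ?thesis by (rule order_trans)
qed

subsection \<open>The error term\<close>

lemma prod_powr_minus_eq_exp:
  fixes h :: "'a \<Rightarrow> real"
  assumes "finite A" "\<And>x. x \<in> A \<Longrightarrow> h x > 0"
  shows "(\<Prod>x\<in>A. h x powr (- r)) = exp (r * (\<Sum>x\<in>A. - ln (h x)))"
proof -
  have "exp (r * (\<Sum>x\<in>A. - ln (h x))) = (\<Prod>x\<in>A. exp (r * - ln (h x)))"
    unfolding sum_distrib_left by (rule exp_sum[OF assms(1)])
  also have "\<dots> = (\<Prod>x\<in>A. h x powr (- r))"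
    using assms(2) by (intro prod.cong) (fastforce simp: powr_def)+
  finally show ?thesis by simp
qed

text \<open>The general mean value is applied to the coefficients of the two powers. The conjugate
  power carries the opposite frequency, and on the diagonal \<open>f n * cnj (f n) = 1\<close>
  removes \<open>f\<close> from the main term.\<close>

lemma mean_value_L_power:
  fixes T y \<delta> :: real
  assumes f: "completely_multiplicative f" "\<And>n. n \<ge> 1 \<Longrightarrow> norm (f n) = 1"
    and T: "T > 0" and \<delta>: "0 \<le> \<delta>" "\<delta> < 1"
  shows "(\<lambda>n. divisor_fun z1 n * divisor_fun z2 n / (of_nat n)\<^sup>2) summable_on smooth_numbers y"
    and "norm (of_real (1 / T) *
             integral {T..2 * T} (\<lambda>t. L_power f (Complex 1 t) y z1 * cnj_L_power f (Complex 1 t) y z2)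
           - (\<Sum>\<^sub>\<infinity>n\<in>smooth_numbers y. divisor_fun z1 n * divisor_fun z2 n / (of_nat n)\<^sup>2))
       \<le> (2 / T) powr \<delta> *
          exp ((norm z1 + norm z2) * (\<Sum>p\<in>primes_upto y. - ln (1 - real p powr (\<delta> - 1))))"
proof -
  define S where "S = smooth_numbers y"
  define a where "a = (\<lambda>n. divisor_fun z1 n * f n / of_nat n)"
  define b where "b = (\<lambda>n. divisor_fun z2 n * cnj (f n) / of_nat n)"
  define s where "s = (\<Sum>p\<in>primes_upto y. - ln (1 - real p powr (\<delta> - 1)))"
  have pos: "n > 0" if "n \<in> S" for n using that by (simp add: S_def smooth_numbers_def)
  have f': "completely_multiplicative (\<lambda>n. cnj (f n))" "\<And>n. n \<ge> 1 \<Longrightarrow> norm (cnj (f n)) = 1"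
    using f completely_multiplicative_cnj by auto
  have powr: "of_nat n powr Complex 1 t = of_nat n * exp (\<i> * of_real (ln (real n) * t))"
    if "n > 0" for n t
    using that by (simp add: of_nat_powr_eq_exp Complex_eq ring_distribs exp_add mult_ac exp_of_real)
  have L: "L_power f (Complex 1 t) y z1 = (\<Sum>\<^sub>\<infinity>m\<in>S. a m * exp (- (\<i> * of_real (ln (real m) * t))))" for t
  proof -
    have "L_power f (Complex 1 t) y z1
        = (\<Sum>\<^sub>\<infinity>n\<in>S. divisor_fun z1 n * (f n / of_nat n powr Complex 1 t))"
      unfolding S_def by (rule L_power_series[OF f]) auto
    also have "\<dots> = (\<Sum>\<^sub>\<infinity>m\<in>S. a m * exp (- (\<i> * of_real (ln (real m) * t))))"
      by (intro infsum_cong) (simp add: powr[OF pos] a_def exp_minus field_simps)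
    finally show ?thesis .
  qed
  have L': "cnj_L_power f (Complex 1 t) y z2 = (\<Sum>\<^sub>\<infinity>m\<in>S. b m * exp (\<i> * of_real (ln (real m) * t)))" for t
  proof -
    have "cnj (Complex 1 t) = Complex 1 (- t)" by (simp add: complex_eq_iff)
    then have "cnj_L_power f (Complex 1 t) y z2 = L_power (\<lambda>n. cnj (f n)) (Complex 1 (- t)) y z2"
      using cnj_L_power_eq[where f = f and s = "Complex 1 t", OF f(2)] by simp
    also have "\<dots> = (\<Sum>\<^sub>\<infinity>n\<in>S. divisor_fun z2 n * (cnj (f n) / of_nat n powr Complex 1 (- t)))"
      unfolding S_def by (rule L_power_series[OF f']) auto
    also have "\<dots> = (\<Sum>\<^sub>\<infinity>m\<in>S. b m * exp (\<i> * of_real (ln (real m) * t)))"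
      by (intro infsum_cong) (simp add: powr[OF pos] b_def exp_minus field_simps)
    finally show ?thesis .
  qed
  have ab: "a n * b n = divisor_fun z1 n * divisor_fun z2 n / (of_nat n)\<^sup>2" if "n \<in> S" for n
  proof -
    have "f n * cnj (f n) = 1" using f(2)[of n] pos[OF that] by (simp flip: complex_norm_square)
    moreover have "a n * b n = divisor_fun z1 n * divisor_fun z2 n * (f n * cnj (f n)) / (of_nat n)\<^sup>2"
      by (simp add: a_def b_def power2_eq_square)
    ultimately show ?thesis by simp
  qed
  have u: "1 - real p powr (\<delta> - 1) > 0" if "p \<in> primes_upto y" for p
    using nat_powr_minus_less_1[OF primes_upto_gt_1[OF that], of "1 - \<delta>"] \<delta> by simp
  have A: "(\<lambda>n. norm (a n) * real n powr \<delta>) summable_on S"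
    "(\<Sum>\<^sub>\<infinity>n\<in>S. norm (a n) * real n powr \<delta>) \<le> exp (norm z1 * s)"
    using divisor_fun_series_bound[OF f \<delta>(2), of z1 y]
    by (simp_all add: a_def S_def s_def prod_powr_minus_eq_exp[OF finite_primes_upto u])
  have B: "(\<lambda>n. norm (b n) * real n powr \<delta>) summable_on S"
    "(\<Sum>\<^sub>\<infinity>n\<in>S. norm (b n) * real n powr \<delta>) \<le> exp (norm z2 * s)"
    using divisor_fun_series_bound[OF f' \<delta>(2), of z2 y]
    by (simp_all add: b_def S_def s_def prod_powr_minus_eq_exp[OF finite_primes_upto u])
  note M = mean_value_Dirichlet_product[OF pos T \<delta>(1) less_imp_le[OF \<delta>(2)] A(1) B(1)]
  have "(\<lambda>n. divisor_fun z1 n * divisor_fun z2 n / (of_nat n)\<^sup>2) summable_on S"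
    using M(1) summable_on_cong[of S, OF ab] by simp
  then show "(\<lambda>n. divisor_fun z1 n * divisor_fun z2 n / (of_nat n)\<^sup>2) summable_on smooth_numbers y"
    by (simp add: S_def)
  have "(\<Sum>\<^sub>\<infinity>n\<in>S. a n * b n)
      = (\<Sum>\<^sub>\<infinity>n\<in>S. divisor_fun z1 n * divisor_fun z2 n / (of_nat n)\<^sup>2)"
    by (intro infsum_cong ab)
  with M(2) have "norm (of_real (1 / T) *
             integral {T..2 * T} (\<lambda>t. L_power f (Complex 1 t) y z1 * cnj_L_power f (Complex 1 t) y z2)
           - (\<Sum>\<^sub>\<infinity>n\<in>S. divisor_fun z1 n * divisor_fun z2 n / (of_nat n)\<^sup>2))
       \<le> (2 / T) powr \<delta> * (\<Sum>\<^sub>\<infinity>n\<in>S. norm (a n) * real n powr \<delta>) *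
             (\<Sum>\<^sub>\<infinity>n\<in>S. norm (b n) * real n powr \<delta>)"
    by (simp only: L L')
  also have "\<dots> \<le> (2 / T) powr \<delta> * exp (norm z1 * s) * exp (norm z2 * s)"
    by (intro mult_mono A B infsum_nonneg mult_nonneg_nonneg) auto
  also have "\<dots> = (2 / T) powr \<delta> * exp ((norm z1 + norm z2) * s)"
    by (simp add: ring_distribs exp_add)
  finally show "norm (of_real (1 / T) *
             integral {T..2 * T} (\<lambda>t. L_power f (Complex 1 t) y z1 * cnj_L_power f (Complex 1 t) y z2)
           - (\<Sum>\<^sub>\<infinity>n\<in>smooth_numbers y. divisor_fun z1 n * divisor_fun z2 n / (of_nat n)\<^sup>2))
       \<le> (2 / T) powr \<delta> *
          exp ((norm z1 + norm z2) * (\<Sum>p\<in>primes_upto y. - ln (1 - real p powr (\<delta> - 1))))"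
    by (simp only: S_def s_def)
qed

text \<open>With \<open>q = ln T / x\<close> the power of \<open>2 / T\<close> contributes
  \<open>- q\<close> and the Euler products at most \<open>3 / 4 * q\<close>, leaving
  \<open>- q / 4\<close>. The factor \<open>exp 1\<close> absorbs the stray \<open>ln 2 / x\<close>
  from the \<open>2\<close> in \<open>2 / T\<close>.\<close>

lemma error_exponent_le:
  fixes T r1 r2 s :: real
  defines "x \<equiv> ln (ln T)"
  assumes T: "T > 0" and x: "ln x \<ge> 1000" "x > 1"
    and r: "0 \<le> r1" "r1 \<le> ln T / (25 * x * ln x)" "0 \<le> r2" "r2 \<le> ln T / (25 * x * ln x)"
    and s: "s \<le> 8 * ln x + 250" and lnT: "ln T > 0"
  shows "(2 / T) powr (1 / x) * exp ((r1 + r2) * s) \<le> exp 1 * exp (- (ln T / (4 * x)))"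
proof -
  define q where "q = ln T / x"
  have q: "q \<ge> 0" using x lnT by (simp add: q_def)
  have "(r1 + r2) * s \<le> (r1 + r2) * (8 * ln x + 250)"
    using r s by (intro mult_left_mono) auto
  also have "\<dots> \<le> (2 * (ln T / (25 * x * ln x))) * (8 * ln x + 250)"
    using r x by (intro mult_right_mono) auto
  \<comment> \<open>The two radii together give \<open>2 / 25\<close>, times \<open>8\<close> for
    the leading part and times \<open>250\<close> for the remainder. With
    \<open>ln x \<ge> 1000\<close> the total is at most \<open>0.66\<close>.\<close>
  also have "\<dots> = q * (16 / 25 + 20 / ln x)"
  proof -
    have "ln x \<noteq> 0" "x \<noteq> 0" using x by auto
    then show ?thesis by (simp add: q_def divide_simps)
  qed
  also have "\<dots> \<le> q * (3 / 4)"
  proof (intro mult_left_mono q)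
    have "20 / ln x \<le> 20 / 1000" using x by (intro divide_left_mono) auto
    then show "16 / 25 + 20 / ln x \<le> 3 / 4" by simp
  qed
  finally have rs: "(r1 + r2) * s \<le> q * (3 / 4)" .
  have "ln 2 / x \<le> 1" using x ln_2_less_1 by (simp add: field_simps)
  moreover have "(1 / x) * ln (2 / T) = ln 2 / x - q"
    using T x by (simp add: q_def ln_div diff_divide_distrib)
  ultimately have "(1 / x) * ln (2 / T) + (r1 + r2) * s \<le> 1 + - (ln T / (4 * x))"
    using rs by (simp add: q_def)
  then show ?thesis
    using T by (simp add: powr_def flip: exp_add)
qed

text \<open>\<open>C\<close> and \<open>T0\<close> are chosen before all other variables, so the
  implied constant is uniform in \<open>y\<close>, \<open>f\<close>, \<open>z1\<close> and
  \<open>z2\<close>. Summability is asserted along with the estimate because an infinite sum without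
  it would have the default value \<open>0\<close>.\<close>

theorem theorem4p1:
  "\<exists>(C::real) (T0::real). \<forall>T\<ge>T0. \<forall>y\<le>(ln T)\<^sup>2. \<forall>f :: nat \<Rightarrow> complex. \<forall>z1 z2 :: complex.
     completely_multiplicative f \<longrightarrow>
     (\<forall>n\<ge>1. norm (f n) = 1) \<longrightarrow>
     norm z1 \<le> ln T / (25 * ln (ln T) * ln (ln (ln T))) \<longrightarrow>
     norm z2 \<le> ln T / (25 * ln (ln T) * ln (ln (ln T))) \<longrightarrow>
     (\<lambda>n. divisor_fun z1 n * divisor_fun z2 n / (of_nat n)\<^sup>2) summable_on smooth_numbers y \<and>
     norm (of_real (1 / T) *
             integral {T..2 * T} (\<lambda>t. L_power f (Complex 1 t) y z1 * cnj_L_power f (Complex 1 t) y z2)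
           - (\<Sum>\<^sub>\<infinity>n\<in>smooth_numbers y. divisor_fun z1 n * divisor_fun z2 n / (of_nat n)\<^sup>2))
       \<le> C * exp (- (ln T / (4 * ln (ln T))))"
\<comment> \<open>The triple exponential makes \<open>ln (ln (ln T))\<close> at least
  \<open>1000\<close>, as the exponent estimate requires; \<open>exp 1\<close> is the constant from
  that estimate.\<close>
proof (rule exI[of _ "exp 1"], rule exI[of _ "exp (exp (exp 1000))"], intro allI impI)
  fix T y :: real and f :: "nat \<Rightarrow> complex" and z1 z2 :: complex
  assume T0: "exp (exp (exp 1000)) \<le> T" and y: "y \<le> (ln T)\<^sup>2"
    and f: "completely_multiplicative f" "\<forall>n\<ge>1. norm (f n) = 1"
    and z: "norm z1 \<le> ln T / (25 * ln (ln T) * ln (ln (ln T)))"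
           "norm z2 \<le> ln T / (25 * ln (ln T) * ln (ln (ln T)))"
  define x where "x = ln (ln T)"
  have T: "T > 0" using T0 by (rule less_le_trans[OF exp_gt_zero])
  have lnT: "ln T \<ge> exp (exp 1000)" using T T0 by (simp add: ln_ge_iff)
  then have lnT0: "ln T > 0" by (rule less_le_trans[OF exp_gt_zero])
  then have x: "x \<ge> exp 1000" using lnT by (simp add: x_def ln_ge_iff)
  then have x0: "x > 0" by (rule less_le_trans[OF exp_gt_zero])
  then have lnx: "ln x \<ge> 1000" using x by (simp add: ln_ge_iff)
  have x4: "x \<ge> 4" using x exp_ge_add_one_self[of 1000] by simp
  \<comment> \<open>This is how the hypothesis on \<open>y\<close> enters: it becomes the range
    \<open>exp (2 * x)\<close> of the prime sum bound.\<close>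
  have "(ln T)\<^sup>2 = exp (2 * x)"
    using lnT0 by (simp add: x_def exp_double)
  then have "(\<Sum>p\<in>primes_upto y. - ln (1 - real p powr (1 / x - 1))) \<le> 8 * ln x + 250"
    using y by (intro sum_primes_powr_le[OF x4]) simp
  then have err: "(2 / T) powr (1 / x) *
      exp ((norm z1 + norm z2) * (\<Sum>p\<in>primes_upto y. - ln (1 - real p powr (1 / x - 1))))
      \<le> exp 1 * exp (- (ln T / (4 * ln (ln T))))"
    using error_exponent_le[of T "norm z1" "norm z2"] T lnT0 lnx x4 z by (simp add: x_def)
  have \<delta>: "0 \<le> 1 / x" "1 / x < 1" using x4 by auto
  have f2: "norm (f n) = 1" if "n \<ge> 1" for n using f(2) that by blast
  note M = mean_value_L_power[OF f(1) f2 T \<delta>, where ?z1.0 = z1 and ?z2.0 = z2 and y = y]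
  show "(\<lambda>n. divisor_fun z1 n * divisor_fun z2 n / (of_nat n)\<^sup>2) summable_on smooth_numbers y \<and>
     norm (of_real (1 / T) *
             integral {T..2 * T} (\<lambda>t. L_power f (Complex 1 t) y z1 * cnj_L_power f (Complex 1 t) y z2)
           - (\<Sum>\<^sub>\<infinity>n\<in>smooth_numbers y. divisor_fun z1 n * divisor_fun z2 n / (of_nat n)\<^sup>2))
       \<le> exp 1 * exp (- (ln T / (4 * ln (ln T))))"
    using M(1) order_trans[OF M(2) err] by simp
qed

end
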